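(* Let $d\ge 1$, $n\ge 1$ and $1\le\rho\le n$ be integers. Let $\mathbb{F}$ be a field with $\mathrm{char}(\mathbb{F})=0$ or $\mathrm{char}(\mathbb{F})>d$, let $\mathbb{L}/\mathbb{F}$ be a cyclic Galois extension of degree $n$, and let $\sigma$ be a generator of $\mathrm{Gal}(\mathbb{L}/\mathbb{F})$. Let $\alpha^{(1)},\ldots,\alpha^{(d)}\in\mathbb{L}^n$ be $\mathbb{F}$-bases of $\mathbb{L}$. Then for every $f\in \mathcal{C}_{\rho}^{n,d}(\alpha^{(1)},\ldots,\alpha^{(d)})\setminus\{0\}$ we have $\mathrm{ess}(f)\geq\rho$.
   Context: For a field $K$, let $S_{n,d}(K)=K[x_1,\ldots,x_n]_d$ be the space of homogeneous polynomials of degree $d$ (including $0$), and $T_{n,d}(K)=K[\partial_1,\ldots,\partial_n]_d$ the space of homogeneous differential operators of degree $d$ (including $0$), acting on polynomials by $\partial_i\circ f=\partial f/\partial x_i$. For $v=(v_1,\ldots,v_n)\in K^n$ write $v(\partial)=v_1\partial_1+\ldots+v_n\partial_n\in T_{n,1}(K)$. Essential rank: for $f\in S_{n,d}(\mathbb{F})$, $\mathrm{ess}(f)$ is the minimal $r\in\mathbb{Z}_{\ge0}$ such that there are linear forms $\ell_1,\ldots,\ell_r\in S_{n,1}(\mathbb{F})$ with $f\in\mathbb{F}[\ell_1,\ldots,\ell_r]$. A vector $\alpha=(\alpha_1,\ldots,\alpha_n)\in\mathbb{L}^n$ is called an $\mathbb{F}$-basis of $\mathbb{L}$ if its entries form one;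 $\sigma$ acts on $\mathbb{L}^n$ entrywise. For $B\subseteq T_{n,d}(\mathbb{L})$ let $B^\perp=\{f\in S_{n,d}(\mathbb{L})\mid D\circ f=0\text{ for all }D\in B\}$. Define $$\mathcal{C}_{\rho}^{n,d}(\alpha^{(1)},\ldots,\alpha^{(d)})=\left\{\alpha^{(1)}(\partial)\prod_{j=2}^d\sigma^{r_j}(\alpha^{(j)})(\partial)\;\middle|\;0\le r_2,\ldots,r_d\le\rho-2\right\}^\perp\cap S_{n,d}(\mathbb{F}),$$ where the $r_j$ are integers. *)

theory Defs
  imports
    "HOL-Library.Poly_Mapping"
    "HOL-Algebra.Generated_Groups"
    "Jordan_Normal_Form.Matrix"
begin

section \<open>Polynomials and differential operators\<close>

text \<open>
  A polynomial over \<open>'a\<close> in variables indexed by natural numbers is a finitely supported map from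
  exponent vectors to coefficients. The variables of an \<open>n\<close>-variate polynomial are those with
  indices \<open>1, \<dots>, n\<close>.
\<close>

type_synonym 'a mpol = "(nat \<Rightarrow>\<^sub>0 nat) \<Rightarrow>\<^sub>0 'a"

definition forms :: "nat \<Rightarrow> nat \<Rightarrow> 'a::zero mpol set" where
  "forms n d = {f. \<forall>m\<in>Poly_Mapping.keys f. Poly_Mapping.keys m \<subseteq> {1..n} \<and>
     (\<Sum>i\<in>Poly_Mapping.keys m. Poly_Mapping.lookup m i) = d}"

text \<open>
  Constant-coefficient differential operators are written as polynomials in the symbols
  \<open>\<partial>\<^sub>1, \<dots>, \<partial>\<^sub>n\<close>, so that \<open>T\<^sub>n\<^sub>,\<^sub>d\<close> is represented by \<^term>\<open>forms n d\<close> as well and the product of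
  operators is the product of polynomials.
\<close>

definition pd :: "nat \<Rightarrow> 'a::comm_semiring_1 mpol \<Rightarrow> 'a mpol" where
  "pd i f = (\<Sum>m\<in>Poly_Mapping.keys f.
     Poly_Mapping.single (m - Poly_Mapping.single i 1)
       (of_nat (Poly_Mapping.lookup m i) * Poly_Mapping.lookup f m))"

text \<open>
  The action of \<open>\<partial>\<^sup>a = \<Prod>\<^sub>i \<partial>\<^sub>i\<^bsup>a i\<^esup>\<close>; partial derivatives commute, so the order chosen by the list is
  immaterial.
\<close>

definition pd_monom :: "(nat \<Rightarrow>\<^sub>0 nat) \<Rightarrow> 'a::comm_semiring_1 mpol \<Rightarrow> 'a mpol" where
  "pd_monom a f = foldr (\<lambda>i. pd i ^^ Poly_Mapping.lookup a i)
     (sorted_list_of_set (Poly_Mapping.keys a)) f"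

definition diff_act :: "'a::comm_semiring_1 mpol \<Rightarrow> 'a mpol \<Rightarrow> 'a mpol" where
  "diff_act D f = (\<Sum>a\<in>Poly_Mapping.keys D.
     Poly_Mapping.single 0 (Poly_Mapping.lookup D a) * pd_monom a f)"

definition dir_op :: "nat \<Rightarrow> (nat \<Rightarrow> 'a::comm_semiring_1) \<Rightarrow> 'a mpol" where
  "dir_op n v = (\<Sum>i\<in>{1..n}. Poly_Mapping.single (Poly_Mapping.single i 1) (v i))"

definition perp :: "nat \<Rightarrow> nat \<Rightarrow> 'a::comm_semiring_1 mpol set \<Rightarrow> 'a mpol set" where
  "perp n d B = {f \<in> forms n d. \<forall>D\<in>B. diff_act D f = 0}"


section \<open>Essential rank\<close>

text \<open>The subalgebra generated by the constants and \<open>A\<close>, i.e. \<open>F[A]\<close>.\<close>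

inductive_set adjoin :: "'a::comm_semiring_1 mpol set \<Rightarrow> 'a mpol set" for A where
  const: "Poly_Mapping.single 0 c \<in> adjoin A"
| gen: "f \<in> A \<Longrightarrow> f \<in> adjoin A"
| add: "f \<in> adjoin A \<Longrightarrow> g \<in> adjoin A \<Longrightarrow> f + g \<in> adjoin A"
| mult: "f \<in> adjoin A \<Longrightarrow> g \<in> adjoin A \<Longrightarrow> f * g \<in> adjoin A"

definition ess :: "nat \<Rightarrow> 'a::comm_semiring_1 mpol \<Rightarrow> nat" where
  "ess n f = (LEAST r. \<exists>l. (\<forall>i\<in>{1..r}. l i \<in> forms n 1) \<and> f \<in> adjoin (l ` {1..r}))"


section \<open>Cyclic Galois extensions\<close>

text \<open>
  A field extension \<open>L/F\<close> is given by a field homomorphism \<open>\<iota> :: 'f \<Rightarrow> 'l\<close>, which is automatically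
  injective. The Galois group consists of the automorphisms of \<open>'l\<close> that fix the image of \<open>\<iota>\<close>
  pointwise, under composition.
\<close>

definition ext_scale :: "('f \<Rightarrow> 'l::times) \<Rightarrow> 'f \<Rightarrow> 'l \<Rightarrow> 'l" where
  "ext_scale \<iota> c x = \<iota> c * x"

definition Gal :: "('f \<Rightarrow> 'l::field) \<Rightarrow> ('l \<Rightarrow> 'l) monoid" where
  "Gal \<iota> = \<lparr>carrier = {\<tau>. field_hom \<tau> \<and> bij \<tau> \<and> (\<forall>c. \<tau> (\<iota> c) = \<iota> c)}, monoid.mult = (\<circ>), one = id\<rparr>"

text \<open>
  A finite extension is Galois if \<open>F\<close> is the fixed field of \<open>Gal(L/F)\<close>. The conjunct \<open>n > 0\<close> excludes
  infinite extensions, for which \<^const>\<open>vector_space.dim\<close> is \<open>0\<close>.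
\<close>

definition galois_ext :: "('f::field \<Rightarrow> 'l::field) \<Rightarrow> nat \<Rightarrow> bool" where
  "galois_ext \<iota> n \<longleftrightarrow> field_hom \<iota> \<and> n > 0 \<and> vector_space.dim (ext_scale \<iota>) UNIV = n \<and>
     {x. \<forall>\<tau>\<in>carrier (Gal \<iota>). \<tau> x = x} = range \<iota>"

definition cyclic_galois_ext :: "('f::field \<Rightarrow> 'l::field) \<Rightarrow> nat \<Rightarrow> ('l \<Rightarrow> 'l) \<Rightarrow> bool" where
  "cyclic_galois_ext \<iota> n \<sigma> \<longleftrightarrow>
     galois_ext \<iota> n \<and> \<sigma> \<in> carrier (Gal \<iota>) \<and> generate (Gal \<iota>) {\<sigma>} = carrier (Gal \<iota>)"

definition is_ext_basis :: "('f::field \<Rightarrow> 'l::field) \<Rightarrow> nat \<Rightarrow> (nat \<Rightarrow> 'l) \<Rightarrow> bool" where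
  "is_ext_basis \<iota> n v \<longleftrightarrow> inj_on v {1..n} \<and>
     \<not> module.dependent (ext_scale \<iota>) (v ` {1..n}) \<and>
     module.span (ext_scale \<iota>) (v ` {1..n}) = UNIV"


section \<open>The code\<close>

text \<open>
  The intersection with \<open>S\<^sub>n\<^sub>,\<^sub>d(F)\<close> is taken along the coefficientwise embedding \<open>\<iota>\<close>. The bound
  \<open>r\<^sub>j \<le> \<rho> - 2\<close> is stated over the integers: for \<open>\<rho> = 1\<close> and \<open>d \<ge> 2\<close> there are no admissible exponents.
\<close>

definition rank_code ::
  "('f::field \<Rightarrow> 'l::field) \<Rightarrow> ('l \<Rightarrow> 'l) \<Rightarrow> nat \<Rightarrow> nat \<Rightarrow> nat \<Rightarrow> (nat \<Rightarrow> nat \<Rightarrow> 'l) \<Rightarrow> 'f mpol set" where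
  "rank_code \<iota> \<sigma> \<rho> n d \<alpha> = {f \<in> forms n d. Poly_Mapping.map \<iota> f \<in>
     perp n d {dir_op n (\<alpha> 1) * (\<Prod>j\<in>{2..d}. dir_op n (\<lambda>i. (\<sigma> ^^ r j) (\<alpha> j i))) | r :: nat \<Rightarrow> nat.
                 \<forall>j\<in>{2..d}. int (r j) \<le> int \<rho> - 2}}"

end

theory Submission
  imports Defs
begin

text \<open>
  If \<open>f \<in> F[l\<^sub>1, \<dots>, l\<^sub>r]\<close>, then the gradient of every derivative \<open>g\<close> of \<open>f\<close> is an \<open>L[x]\<close>-combination of
  the coefficient vectors of the \<open>l\<^sub>i\<close>, which lie in \<open>F\<^sup>n\<close>. A vector \<open>u = \<Sum>\<^sub>i h\<^sub>i l\<^sub>i\<close> of this kind which is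
  orthogonal to \<open>\<alpha>, \<sigma>(\<alpha>), \<dots>, \<sigma>\<^bsup>r-1\<^esup>(\<alpha>)\<close> for a basis \<open>\<alpha>\<close> of \<open>L/F\<close> vanishes: after scaling to \<open>h\<^sub>r = 1\<close>, the
  vector \<open>u - \<sigma>(u)\<close> has \<open>r - 1\<close> terms and is orthogonal to \<open>\<sigma>(\<alpha>), \<dots>, \<sigma>\<^bsup>r-1\<^esup>(\<alpha>)\<close>, so it is zero by
  induction; hence \<open>u \<in> F\<^sup>n\<close>, and orthogonality to \<open>\<alpha>\<close> gives \<open>u = 0\<close>. So for \<open>r \<le> \<rho> - 1\<close> the factors
  \<open>\<sigma>\<^bsup>s\<^esup>(\<alpha>\<^bsup>(j)\<^esup>)(\<partial>)\<close>, \<open>s \<le> \<rho> - 2\<close>, can be cancelled one at a time from \<open>j = d\<close> down to \<open>j = 2\<close>, as each partial result is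
  a form of positive degree, which is zero once its gradient is. What remains is \<open>\<alpha>\<^bsup>(1)\<^esup>(\<partial>) f = 0\<close>,
  and \<open>f\<close> has coefficients in \<open>F\<close>, so its gradient vanishes.
\<close>

section \<open>Coefficients and partial derivatives of polynomials\<close>

abbreviation const_poly :: "'a::zero \<Rightarrow> 'a mpol" where
  "const_poly c \<equiv> Poly_Mapping.single 0 c"

text \<open>Updating at a fresh key amounts to adding a monomial, so additive identities only have
  to be checked on monomials.\<close>

lemma poly_mapping_monomial_induct [case_names zero add]:
  fixes f :: "'k \<Rightarrow>\<^sub>0 'a::comm_monoid_add"
  assumes "P 0" and "\<And>f a b. P f \<Longrightarrow> P (f + Poly_Mapping.single a b)"
  shows "P f"
proof (induction f rule: update_induct)
  case const
  show ?case by (rule assms(1))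
next
  case (update f a b)
  have "Poly_Mapping.update a b f = f + Poly_Mapping.single a b"
    using update(1)
    by (intro poly_mapping_eqI)
       (auto simp: lookup_update lookup_add lookup_single when_def in_keys_iff)
  then show ?case using assms(2)[OF update(3)] by simp
qed

lemma lookup_const_mult:
  fixes f :: "'a::comm_semiring_1 mpol"
  shows "Poly_Mapping.lookup (const_poly c * f) m = c * Poly_Mapping.lookup f m"
  by (simp add: mult_map_scale_conv_mult[symmetric] Poly_Mapping.map.rep_eq when_def)

text \<open>Truncated subtraction in \<open>pd\<close> leaves an exponent without \<open>i\<close>
  unchanged, but its coefficient is then 0. So only \<open>m + Poly_Mapping.single i 1\<close>
  contributes at \<open>m\<close>.\<close>

lemma lookup_pd:
  fixes f :: "'a::comm_semiring_1 mpol"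
  shows "Poly_Mapping.lookup (pd i f) m =
    of_nat (Poly_Mapping.lookup m i + 1) * Poly_Mapping.lookup f (m + Poly_Mapping.single i 1)"
proof -
  let ?e = "Poly_Mapping.single i (1::nat)"
  have key: "(of_nat (Poly_Mapping.lookup k i) * Poly_Mapping.lookup f k when k - ?e = m) =
      (if k = m + ?e then of_nat (Poly_Mapping.lookup m i + 1) * Poly_Mapping.lookup f (m + ?e) else 0)"
    for k
  proof (cases "Poly_Mapping.lookup k i = 0")
    case True
    then have "k \<noteq> m + ?e" by (auto simp: lookup_add)
    then show ?thesis using True by (simp add: when_def)
  next
    case False
    then have k: "k - ?e + ?e = k"
      by (intro poly_mapping_eqI) (auto simp: lookup_add lookup_minus lookup_single when_def)
    then have "k - ?e = m \<longleftrightarrow> k = m + ?e" by auto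
    then show ?thesis by (auto simp: when_def lookup_add)
  qed
  have "Poly_Mapping.lookup (pd i f) m = (\<Sum>k\<in>Poly_Mapping.keys f.
      (of_nat (Poly_Mapping.lookup k i) * Poly_Mapping.lookup f k when k - ?e = m))"
    by (simp add: pd_def lookup_sum lookup_single)
  also have "\<dots> = of_nat (Poly_Mapping.lookup m i + 1) * Poly_Mapping.lookup f (m + ?e)"
    unfolding key by (simp add: sum.delta in_keys_iff)
  finally show ?thesis .
qed

lemma pd_zero [simp]: "pd i 0 = 0"
  by (simp add: pd_def)

lemma pd_add:
  fixes f g :: "'a::comm_semiring_1 mpol"
  shows "pd i (f + g) = pd i f + pd i g"
  by (intro poly_mapping_eqI) (simp add: lookup_pd lookup_add distrib_left)

lemma pd_single:
  fixes c :: "'a::comm_semiring_1"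
  shows "pd i (Poly_Mapping.single a c) =
    Poly_Mapping.single (a - Poly_Mapping.single i 1) (of_nat (Poly_Mapping.lookup a i) * c)"
  by (cases "c = 0") (simp_all add: pd_def)

lemma pd_commute:
  fixes f :: "'a::comm_semiring_1 mpol"
  shows "pd i (pd j f) = pd j (pd i f)"
  by (intro poly_mapping_eqI)
     (auto simp: lookup_pd lookup_add lookup_single when_def ac_simps)

lemma pd_mult:
  fixes f g :: "'a::comm_semiring_1 mpol"
  shows "pd i (f * g) = pd i f * g + f * pd i g"
proof (induction f rule: poly_mapping_monomial_induct)
  case zero
  show ?case by simp
next
  case (add f a b)
  have "pd i (Poly_Mapping.single a b * g) =
      pd i (Poly_Mapping.single a b) * g + Poly_Mapping.single a b * pd i g"
  proof (induction g rule: poly_mapping_monomial_induct)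
    case zero
    show ?case by simp
  next
    case (add g a' b')
    let ?e = "Poly_Mapping.single i (1::nat)"
    let ?A = "Poly_Mapping.lookup a i" and ?A' = "Poly_Mapping.lookup a' i"
    \<comment> \<open>The two exponents may differ if \<open>i\<close> does not occur in
      \<open>a\<close>, as subtraction truncates; the coefficient is 0 in that case.\<close>
    have 1: "Poly_Mapping.single (a + a' - ?e) (of_nat ?A * (b * b')) =
        Poly_Mapping.single (a - ?e + a') (of_nat ?A * (b * b'))"
    proof (cases "?A = 0")
      case False
      then have "a + a' - ?e = a - ?e + a'"
        by (intro poly_mapping_eqI) (auto simp: lookup_add lookup_minus lookup_single when_def)
      then show ?thesis by simp
    qed simp
    have 2: "Poly_Mapping.single (a + a' - ?e) (of_nat ?A' * (b * b')) =
        Poly_Mapping.single (a + (a' - ?e)) (of_nat ?A' * (b * b'))"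
    proof (cases "?A' = 0")
      case False
      then have "a + a' - ?e = a + (a' - ?e)"
        by (intro poly_mapping_eqI) (auto simp: lookup_add lookup_minus lookup_single when_def)
      then show ?thesis by simp
    qed simp
    have "pd i (Poly_Mapping.single a b * Poly_Mapping.single a' b') =
        Poly_Mapping.single (a + a' - ?e) (of_nat ?A * (b * b')) +
        Poly_Mapping.single (a + a' - ?e) (of_nat ?A' * (b * b'))"
      by (simp add: mult_single pd_single lookup_add single_add distrib_right)
    also have "\<dots> = pd i (Poly_Mapping.single a b) * Poly_Mapping.single a' b' +
        Poly_Mapping.single a b * pd i (Poly_Mapping.single a' b')"
      unfolding 1 2 by (simp add: mult_single pd_single mult.assoc mult.left_commute[of b])
    finally have "pd i (Poly_Mapping.single a b * Poly_Mapping.single a' b') =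
        pd i (Poly_Mapping.single a b) * Poly_Mapping.single a' b' +
        Poly_Mapping.single a b * pd i (Poly_Mapping.single a' b')" .
    then show ?case using add by (simp add: pd_add distrib_left ac_simps)
  qed
  then show ?case using add by (simp add: pd_add distrib_left distrib_right ac_simps)
qed

lemma pd_const_mult:
  fixes f :: "'a::comm_semiring_1 mpol"
  shows "pd i (const_poly c * f) = const_poly c * pd i f"
  by (simp add: pd_mult pd_single)

section \<open>The action of differential operators\<close>

text \<open>Extra indices contribute \<open>pd i ^^ 0\<close>. A common index set makes exponents
  with different keys comparable.\<close>

lemma pd_monom_superset:
  fixes f :: "'a::comm_semiring_1 mpol"
  assumes "finite S" "Poly_Mapping.keys a \<subseteq> S"
  shows "pd_monom a f =
    foldr (\<lambda>i. pd i ^^ Poly_Mapping.lookup a i) (sorted_list_of_set S) f"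
proof -
  let ?P = "\<lambda>i. Poly_Mapping.lookup a i \<noteq> 0"
  have skip: "foldr (\<lambda>i. pd i ^^ Poly_Mapping.lookup a i) (filter ?P xs) f =
      foldr (\<lambda>i. pd i ^^ Poly_Mapping.lookup a i) xs f" for xs
    by (induction xs) auto
  have "filter ?P (sorted_list_of_set S) = sorted_list_of_set (Poly_Mapping.keys a)"
    using assms by (intro sorted_distinct_set_unique) (auto simp: sorted_wrt_filter in_keys_iff)
  then show ?thesis
    unfolding pd_monom_def using skip[of "sorted_list_of_set S"] by simp
qed

lemma pd_funpow_commute:
  fixes f :: "'a::comm_semiring_1 mpol"
  shows "(pd i ^^ k) (foldr (\<lambda>i. pd i ^^ e i) xs f) = foldr (\<lambda>i. pd i ^^ e i) xs ((pd i ^^ k) f)"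
proof -
  have step: "pd i ((pd j ^^ m) g) = (pd j ^^ m) (pd i g)" for j m and g :: "'a mpol"
    by (induction m) (simp_all add: pd_commute[of i j])
  have step': "(pd i ^^ k) ((pd j ^^ m) g) = (pd j ^^ m) ((pd i ^^ k) g)" for j m and g :: "'a mpol"
    by (induction k) (simp_all add: step)
  show ?thesis by (induction xs) (simp_all add: step')
qed

text \<open>Over a common index list, the powers can be separated into those of \<open>a\<close> and
  those of \<open>b\<close> because partial derivatives commute.\<close>

lemma pd_monom_plus:
  fixes f :: "'a::comm_semiring_1 mpol"
  shows "pd_monom (a + b) f = pd_monom a (pd_monom b f)"
proof -
  let ?S = "Poly_Mapping.keys a \<union> Poly_Mapping.keys b"
  have "foldr (\<lambda>i. pd i ^^ (Poly_Mapping.lookup a i + Poly_Mapping.lookup b i)) xs f =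
      foldr (\<lambda>i. pd i ^^ Poly_Mapping.lookup a i) xs
        (foldr (\<lambda>i. pd i ^^ Poly_Mapping.lookup b i) xs f)" for xs
    by (induction xs) (simp_all add: funpow_add pd_funpow_commute)
  moreover have "Poly_Mapping.keys (a + b) \<subseteq> ?S" by (rule keys_add)
  ultimately show ?thesis
    by (simp add: pd_monom_superset[of ?S] lookup_add)
qed

lemma pd_monom_induct:
  fixes P :: "'a::comm_semiring_1 mpol \<Rightarrow> bool"
  assumes "\<And>i g. P g \<Longrightarrow> P (pd i g)" and "P f"
  shows "P (pd_monom a f)"
proof -
  have step: "P ((pd i ^^ k) g)" if "P g" for i k g
    using that by (induction k) (auto intro: assms(1))
  have "P (foldr (\<lambda>i. pd i ^^ e i) xs f)" for e xs
    by (induction xs) (auto intro: step assms(2))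
  then show ?thesis unfolding pd_monom_def .
qed

lemma pd_monom_zero [simp]: "pd_monom 0 f = f"
  by (simp add: pd_monom_def)

lemma pd_monom_variable [simp]:
  "pd_monom (Poly_Mapping.single i (Suc 0)) f = pd i f"
  by (simp add: pd_monom_def)

lemma pd_monom_0 [simp]: "pd_monom a 0 = 0"
  by (rule pd_monom_induct[where P = "\<lambda>f. f = 0"]) auto

lemma pd_monom_add:
  fixes f g :: "'a::comm_semiring_1 mpol"
  shows "pd_monom a (f + g) = pd_monom a f + pd_monom a g"
proof -
  have step: "(pd i ^^ k) (f + g) = (pd i ^^ k) f + (pd i ^^ k) g" for i k and f g :: "'a mpol"
    by (induction k) (simp_all add: pd_add)
  have "foldr (\<lambda>i. pd i ^^ e i) xs (f + g) =
      foldr (\<lambda>i. pd i ^^ e i) xs f + foldr (\<lambda>i. pd i ^^ e i) xs g" for e xs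
    by (induction xs) (simp_all add: step)
  then show ?thesis unfolding pd_monom_def .
qed

lemma pd_monom_const_mult:
  fixes f :: "'a::comm_semiring_1 mpol"
  shows "pd_monom a (const_poly c * f) = const_poly c * pd_monom a f"
proof -
  have step: "(pd i ^^ k) (const_poly c * f) = const_poly c * (pd i ^^ k) f" for i k and f :: "'a mpol"
    by (induction k) (simp_all add: pd_const_mult)
  have "foldr (\<lambda>i. pd i ^^ e i) xs (const_poly c * f) =
      const_poly c * foldr (\<lambda>i. pd i ^^ e i) xs f" for e xs
    by (induction xs) (simp_all add: step)
  then show ?thesis unfolding pd_monom_def .
qed

lemma diff_act_superset:
  fixes f :: "'a::comm_semiring_1 mpol"
  assumes "finite S" "Poly_Mapping.keys D \<subseteq> S"
  shows "diff_act D f = (\<Sum>a\<in>S. const_poly (Poly_Mapping.lookup D a) * pd_monom a f)"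
  unfolding diff_act_def
  by (rule sum.mono_neutral_left) (use assms in \<open>auto simp: in_keys_iff\<close>)

lemma diff_act_add_left:
  fixes f :: "'a::comm_semiring_1 mpol"
  shows "diff_act (D + E) f = diff_act D f + diff_act E f"
proof -
  let ?S = "Poly_Mapping.keys D \<union> Poly_Mapping.keys E"
  show ?thesis
    using keys_add[of D E]
    by (simp add: diff_act_superset[of ?S] lookup_add single_add distrib_right sum.distrib)
qed

lemma diff_act_zero_left [simp]: "diff_act 0 f = 0"
  by (simp add: diff_act_def)

lemma diff_act_single:
  fixes f :: "'a::comm_semiring_1 mpol"
  shows "diff_act (Poly_Mapping.single a c) f = const_poly c * pd_monom a f"
  by (cases "c = 0") (simp_all add: diff_act_def)

lemma diff_act_sum_left:
  fixes f :: "'a::comm_semiring_1 mpol"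
  shows "diff_act (sum D S) f = (\<Sum>x\<in>S. diff_act (D x) f)"
  by (induction S rule: infinite_finite_induct) (simp_all add: diff_act_add_left)

lemma diff_act_zero_right [simp]: "diff_act D 0 = 0"
  by (simp add: diff_act_def)

lemma diff_act_add_right:
  fixes f :: "'a::comm_semiring_1 mpol"
  shows "diff_act D (f + g) = diff_act D f + diff_act D g"
  by (simp add: diff_act_def pd_monom_add distrib_left sum.distrib)

text \<open>This lets the factors of a product operator be removed one at a time. Both sides are
  additive in \<open>D\<close> and in \<open>E\<close>, and on monomials the claim reduces to
  \<open>pd_monom_plus\<close>.\<close>

lemma diff_act_mult:
  fixes f :: "'a::comm_semiring_1 mpol"
  shows "diff_act (D * E) f = diff_act D (diff_act E f)"
proof (induction D rule: poly_mapping_monomial_induct)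
  case (add D a b)
  have "diff_act (Poly_Mapping.single a b * E) f = diff_act (Poly_Mapping.single a b) (diff_act E f)"
  proof (induction E rule: poly_mapping_monomial_induct)
    case (add E a' b')
    have "diff_act (Poly_Mapping.single a b * Poly_Mapping.single a' b') f =
        diff_act (Poly_Mapping.single a b) (diff_act (Poly_Mapping.single a' b') f)"
      by (simp add: mult_single[of a b a' b'] diff_act_single pd_monom_plus pd_monom_const_mult
          mult.assoc[symmetric]) (simp add: mult_single)
    then show ?case using add by (simp add: distrib_left diff_act_add_left diff_act_add_right)
  qed simp
  then show ?case using add by (simp add: distrib_right diff_act_add_left)
qed simp

lemma diff_act_dir_op:
  fixes f :: "'a::comm_semiring_1 mpol"
  shows "diff_act (dir_op n v) f = (\<Sum>i\<in>{1..n}. const_poly (v i) * pd i f)"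
  by (simp add: dir_op_def diff_act_sum_left diff_act_single)

section \<open>Subalgebras generated by linear forms, and gradients of their elements\<close>

lemma adjoin_zero: "(0::'a::comm_semiring_1 mpol) \<in> adjoin A"
  using adjoin.const[of 0 A] by simp

lemma adjoin_sum:
  fixes F :: "'b \<Rightarrow> 'a::comm_semiring_1 mpol"
  assumes "\<And>x. x \<in> S \<Longrightarrow> F x \<in> adjoin A"
  shows "sum F S \<in> adjoin A"
  using assms
  by (induction S rule: infinite_finite_induct) (auto intro: adjoin_zero adjoin.add)

text \<open>An exponent of degree 1 that involves \<open>j\<close> is the unit vector at
  \<open>j\<close>, so the derivative has only a constant term.\<close>

lemma pd_linear_form:
  fixes l :: "'a::comm_semiring_1 mpol"
  assumes "l \<in> forms n 1"
  shows "pd j l = const_poly (Poly_Mapping.lookup l (Poly_Mapping.single j 1))"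
proof (rule poly_mapping_eqI)
  fix m :: "nat \<Rightarrow>\<^sub>0 nat"
  have "Poly_Mapping.lookup l (m + Poly_Mapping.single j 1) = 0" if "m \<noteq> 0"
  proof (rule ccontr)
    let ?k = "m + Poly_Mapping.single j (1::nat)"
    assume "Poly_Mapping.lookup l ?k \<noteq> 0"
    then have s: "sum (Poly_Mapping.lookup ?k) (Poly_Mapping.keys ?k) = 1"
      using assms by (auto simp: forms_def in_keys_iff)
    obtain i where i: "Poly_Mapping.lookup m i > 0"
      using \<open>m \<noteq> 0\<close> by (metis poly_mapping_eqI lookup_zero gr0I)
    have k: "i \<in> Poly_Mapping.keys ?k" "j \<in> Poly_Mapping.keys ?k"
      using i by (auto simp: in_keys_iff lookup_add)
    have "sum (Poly_Mapping.lookup ?k) {i, j} \<le> sum (Poly_Mapping.lookup ?k) (Poly_Mapping.keys ?k)"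
      using k by (intro sum_mono2) auto
    \<comment> \<open>For \<open>i = j\<close> the set is a singleton, but the entry of
      \<open>?k\<close> there is at least 2.\<close>
    moreover have "sum (Poly_Mapping.lookup ?k) {i, j} \<ge> 2"
      using i by (cases "i = j") (auto simp: lookup_add lookup_single)
    ultimately show False using s by simp
  qed
  then show "Poly_Mapping.lookup (pd j l) m =
      Poly_Mapping.lookup (const_poly (Poly_Mapping.lookup l (Poly_Mapping.single j 1))) m"
    by (cases "m = 0") (simp_all add: lookup_pd lookup_single)
qed

text \<open>The derivatives of the generators are constants, so the product rule never leaves the
  subalgebra.\<close>

lemma pd_adjoin:
  fixes g :: "'a::comm_semiring_1 mpol"
  assumes "A \<subseteq> forms n 1" "g \<in> adjoin A"
  shows "pd i g \<in> adjoin A"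
  using assms(2)
proof induction
  case (const c)
  show ?case by (simp add: pd_single adjoin_zero)
next
  case (gen f)
  then show ?case using assms(1) pd_linear_form[of f n i] by (metis adjoin.const subsetD)
qed (auto simp: pd_add pd_mult intro: adjoin.intros)

lemma diff_act_adjoin:
  fixes g :: "'a::comm_semiring_1 mpol"
  assumes "A \<subseteq> forms n 1" "g \<in> adjoin A"
  shows "diff_act D g \<in> adjoin A"
  unfolding diff_act_def
  by (intro adjoin_sum adjoin.mult adjoin.const pd_monom_induct[where P = "\<lambda>f. f \<in> adjoin A"]
      pd_adjoin[OF assms(1)] assms(2))

text \<open>The \<open>h i\<close> stand for the partial derivatives with respect to the
  \<open>l i\<close>; they are built along the generation of \<open>g\<close>, whose expression in
  the \<open>l i\<close> need not be unique. One \<open>h\<close> serves all \<open>j\<close>, so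
  the gradient is a combination of constant vectors.\<close>

lemma pd_adjoin_chain_rule:
  fixes g :: "'a::comm_semiring_1 mpol"
  assumes "\<And>i. i \<in> I \<Longrightarrow> l i \<in> forms n 1" "finite I" "g \<in> adjoin (l ` I)"
  shows "\<exists>h. \<forall>j. pd j g =
    (\<Sum>i\<in>I. const_poly (Poly_Mapping.lookup (l i) (Poly_Mapping.single j 1)) * h i)"
  using assms(3)
proof induction
  case (const c)
  show ?case by (intro exI[of _ "\<lambda>_. 0"]) (simp add: pd_single)
next
  case (gen f)
  \<comment> \<open>\<open>l\<close> may take the same value at several indices; one index
    \<open>k\<close> is chosen and \<open>h\<close> is its indicator.\<close>
  then obtain k where k: "k \<in> I" "f = l k" by auto
  then show ?case using assms(1)[of k] assms(2)
    by (intro exI[of _ "\<lambda>i. if i = k then 1 else 0"])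
       (simp add: pd_linear_form if_distrib[of "\<lambda>x. _ * x"] cong: if_cong)
next
  case (add f g)
  then obtain h h' where "\<And>j. pd j f =
      (\<Sum>i\<in>I. const_poly (Poly_Mapping.lookup (l i) (Poly_Mapping.single j 1)) * h i)"
    "\<And>j. pd j g =
      (\<Sum>i\<in>I. const_poly (Poly_Mapping.lookup (l i) (Poly_Mapping.single j 1)) * h' i)"
    by blast
  then show ?case
    by (intro exI[of _ "\<lambda>i. h i + h' i"]) (simp add: pd_add distrib_left sum.distrib)
next
  case (mult f g)
  then obtain h h' where "\<And>j. pd j f =
      (\<Sum>i\<in>I. const_poly (Poly_Mapping.lookup (l i) (Poly_Mapping.single j 1)) * h i)"
    "\<And>j. pd j g =
      (\<Sum>i\<in>I. const_poly (Poly_Mapping.lookup (l i) (Poly_Mapping.single j 1)) * h' i)"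
    by blast
  then show ?case
    by (intro exI[of _ "\<lambda>i. h i * g + f * h' i"])
       (simp add: pd_mult distrib_left distrib_right sum.distrib sum_distrib_left sum_distrib_right ac_simps)
qed

section \<open>Homogeneous forms and their degrees\<close>

text \<open>Summing over the fixed range \<open>{1..n}\<close> instead of the keys makes the degree
  additive in the exponent.\<close>

lemma forms_iff:
  "f \<in> forms n d \<longleftrightarrow> (\<forall>m. Poly_Mapping.lookup f m \<noteq> 0 \<longrightarrow>
     (\<forall>i. i \<notin> {1..n} \<longrightarrow> Poly_Mapping.lookup m i = 0) \<and> sum (Poly_Mapping.lookup m) {1..n} = d)"
proof -
  have "sum (Poly_Mapping.lookup m) {1..n} = sum (Poly_Mapping.lookup m) (Poly_Mapping.keys m)"
    if "Poly_Mapping.keys m \<subseteq> {1..n}" for m :: "nat \<Rightarrow>\<^sub>0 nat"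
    using that by (intro sum.mono_neutral_right) (auto simp: in_keys_iff)
  moreover have "Poly_Mapping.keys m \<subseteq> {1..n} \<longleftrightarrow> (\<forall>i. i \<notin> {1..n} \<longrightarrow> Poly_Mapping.lookup m i = 0)"
    for m :: "nat \<Rightarrow>\<^sub>0 nat"
    by (auto simp: in_keys_iff subset_iff)
  ultimately show ?thesis unfolding forms_def by (auto simp: in_keys_iff)
qed

lemma pd_forms:
  fixes f :: "'a::comm_semiring_1 mpol"
  assumes "f \<in> forms n (Suc d)"
  shows "pd i f \<in> forms n d"
  unfolding forms_iff
proof (intro allI impI)
  fix m :: "nat \<Rightarrow>\<^sub>0 nat"
  let ?k = "m + Poly_Mapping.single i (1::nat)"
  assume "Poly_Mapping.lookup (pd i f) m \<noteq> 0"
  then have "Poly_Mapping.lookup f ?k \<noteq> 0" by (auto simp: lookup_pd)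
  then have k: "\<forall>j. j \<notin> {1..n} \<longrightarrow> Poly_Mapping.lookup ?k j = 0"
    "sum (Poly_Mapping.lookup ?k) {1..n} = Suc d"
    using assms unfolding forms_iff by blast+
  \<comment> \<open>Exponents of \<open>f\<close> involve only indices in \<open>{1..n}\<close>, and
    \<open>?k\<close> involves \<open>i\<close>.\<close>
  then have "i \<in> {1..n}" by (metis lookup_add lookup_single_eq add_is_0 one_neq_zero)
  then have "sum (Poly_Mapping.lookup ?k) {1..n} = sum (Poly_Mapping.lookup m) {1..n} + 1"
    by (simp add: lookup_add sum.distrib lookup_single when_def)
  then show "(\<forall>j. j \<notin> {1..n} \<longrightarrow> Poly_Mapping.lookup m j = 0) \<and> sum (Poly_Mapping.lookup m) {1..n} = d"
    using k by (auto simp: lookup_add)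
qed

lemma forms_sum_const_mult:
  fixes F :: "'b \<Rightarrow> 'a::comm_semiring_1 mpol"
  assumes "\<And>x. x \<in> S \<Longrightarrow> F x \<in> forms n d"
  shows "(\<Sum>x\<in>S. const_poly (c x) * F x) \<in> forms n d"
  unfolding forms_iff
proof (intro allI impI)
  fix m :: "nat \<Rightarrow>\<^sub>0 nat"
  assume "Poly_Mapping.lookup (\<Sum>x\<in>S. const_poly (c x) * F x) m \<noteq> 0"
  then obtain x where "x \<in> S" "Poly_Mapping.lookup (F x) m \<noteq> 0"
    unfolding lookup_sum lookup_const_mult
    by (elim sum.not_neutral_contains_not_neutral) (metis mult_zero_right)
  then show "(\<forall>j. j \<notin> {1..n} \<longrightarrow> Poly_Mapping.lookup m j = 0) \<and> sum (Poly_Mapping.lookup m) {1..n} = d"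
    using assms unfolding forms_iff by blast
qed

text \<open>Euler's relation, read coefficientwise: at an exponent \<open>m\<close> of
  \<open>g\<close>, a vanishing \<open>pd j g\<close> makes the entry of \<open>m\<close> at
  \<open>j\<close> zero in the field. The sum of these entries is \<open>d\<close>.\<close>

lemma form_eq_zero_if_pd_zero:
  fixes g :: "'a::field mpol"
  assumes "g \<in> forms n d" "(of_nat d :: 'a) \<noteq> 0" "\<And>j. j \<in> {1..n} \<Longrightarrow> pd j g = 0"
  shows "g = 0"
proof (rule ccontr)
  assume "g \<noteq> 0"
  then obtain m where m: "Poly_Mapping.lookup g m \<noteq> 0"
    by (metis poly_mapping_eqI lookup_zero)
  have "(of_nat (Poly_Mapping.lookup m j) :: 'a) = 0" if j: "j \<in> {1..n}" for j
  proof (cases "Poly_Mapping.lookup m j")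
    case (Suc k)
    let ?m = "m - Poly_Mapping.single j (1::nat)"
    have "?m + Poly_Mapping.single j 1 = m"
      using Suc by (intro poly_mapping_eqI) (auto simp: lookup_add lookup_minus lookup_single when_def)
    moreover have "Poly_Mapping.lookup ?m j + 1 = Poly_Mapping.lookup m j"
      using Suc by (simp add: lookup_minus)
    ultimately have "of_nat (Poly_Mapping.lookup m j) * Poly_Mapping.lookup g m = 0"
      using lookup_pd[of j g ?m] assms(3)[OF j] by (metis lookup_zero)
    then show ?thesis using m by simp
  qed simp
  then have "(\<Sum>j\<in>{1..n}. (of_nat (Poly_Mapping.lookup m j) :: 'a)) = 0" by simp
  moreover have "sum (Poly_Mapping.lookup m) {1..n} = d" using assms(1) m by (auto simp: forms_iff)
  ultimately show False using assms(2) by (simp flip: of_nat_sum)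
qed


lemma diff_act_dir_op_forms:
  fixes f :: "'a::comm_semiring_1 mpol"
  assumes "f \<in> forms n (Suc d)"
  shows "diff_act (dir_op n v) f \<in> forms n d"
  unfolding diff_act_dir_op using assms by (intro forms_sum_const_mult pd_forms)

lemma diff_act_prod_dir_op_forms:
  fixes f :: "'a::comm_semiring_1 mpol"
  assumes "finite S" "f \<in> forms n (d + card S)"
  shows "diff_act (\<Prod>j\<in>S. dir_op n (v j)) f \<in> forms n d"
  using assms
proof (induction S arbitrary: d rule: finite_induct)
  case empty
  have "diff_act 1 f = f" using diff_act_single[of 0 1 f] by simp
  then show ?case using empty by simp
next
  case (insert x S)
  then show ?case
    \<comment> \<open>The product over \<open>S\<close> acts first and leaves degree
      \<open>Suc d\<close>; the factor of \<open>x\<close> lowers it once more.\<close>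
    using insert.IH[of "Suc d"] by (simp add: diff_act_mult diff_act_dir_op_forms)
qed

section \<open>The essential rank is attained\<close>

text \<open>Monomials are built from the constant 1, one variable at a time.\<close>

lemma adjoin_variables:
  fixes f :: "'a::comm_semiring_1 mpol"
  assumes "f \<in> forms n d"
  shows "f \<in> adjoin ((\<lambda>i. Poly_Mapping.single (Poly_Mapping.single i 1) 1) ` {1..n})"
    (is "_ \<in> adjoin ?X")
proof -
  have monom: "Poly_Mapping.keys m \<subseteq> {1..n} \<longrightarrow> Poly_Mapping.single m (1::'a) \<in> adjoin ?X"
    for m :: "nat \<Rightarrow>\<^sub>0 nat"
  proof (induction m rule: poly_mapping_monomial_induct)
    case zero
    show ?case using adjoin.const by blast
  next
    case (add m a b)
    show ?case
    proof (induction b)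
      case 0
      show ?case using add by simp
    next
      case (Suc b)
      have eq: "Poly_Mapping.single (m + Poly_Mapping.single a (Suc b)) (1::'a) =
          Poly_Mapping.single (m + Poly_Mapping.single a b) 1 *
          Poly_Mapping.single (Poly_Mapping.single a 1) 1"
        by (simp add: mult_single add.assoc flip: single_add)
      show ?case
      proof
        assume k: "Poly_Mapping.keys (m + Poly_Mapping.single a (Suc b)) \<subseteq> {1..n}"
        then have "a \<in> {1..n}" "Poly_Mapping.keys (m + Poly_Mapping.single a b) \<subseteq> {1..n}"
          by (auto simp: subset_iff in_keys_iff lookup_add lookup_single when_def split: if_splits)
        then show "Poly_Mapping.single (m + Poly_Mapping.single a (Suc b)) (1::'a) \<in> adjoin ?X"
          unfolding eq using Suc by (blast intro: adjoin.mult adjoin.gen)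
      qed
    qed
  qed
  have "Poly_Mapping.single m c \<in> adjoin ?X" if "Poly_Mapping.keys m \<subseteq> {1..n}" for m c
    using adjoin.mult[OF adjoin.const[of c] monom[rule_format, OF that]] by (simp add: mult_single)
  moreover have "f = (\<Sum>m\<in>Poly_Mapping.keys f. Poly_Mapping.single m (Poly_Mapping.lookup f m))"
    by (rule poly_mapping_eqI) (simp add: lookup_sum lookup_single when_def in_keys_iff)
  moreover have "\<forall>m\<in>Poly_Mapping.keys f. Poly_Mapping.keys m \<subseteq> {1..n}"
    using assms by (simp add: forms_def)
  ultimately show ?thesis by (metis (no_types, lifting) adjoin_sum)
qed

text \<open>The \<open>LEAST\<close> in \<open>ess\<close> is attained once some value works; the
  \<open>n\<close> variables provide one.\<close>

lemma ess_attained: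
  fixes f :: "'a::comm_semiring_1 mpol"
  assumes "f \<in> forms n d"
  obtains l where "\<And>i. i \<in> {1..ess n f} \<Longrightarrow> l i \<in> forms n 1" "f \<in> adjoin (l ` {1..ess n f})"
proof -
  let ?x = "\<lambda>i. Poly_Mapping.single (Poly_Mapping.single i 1) (1::'a)"
  have "(\<forall>i\<in>{1..n}. ?x i \<in> forms n 1) \<and> f \<in> adjoin (?x ` {1..n})"
    using adjoin_variables[OF assms] by (simp add: forms_def)
  then have "\<exists>(r::nat) l. (\<forall>i\<in>{1..r}. l i \<in> forms n 1) \<and> f \<in> adjoin (l ` {1..r})"
    by (intro exI[of _ n] exI[of _ ?x])
  then have "\<exists>l. (\<forall>i\<in>{1..ess n f}. l i \<in> forms n 1) \<and> f \<in> adjoin (l ` {1..ess n f})"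
    unfolding ess_def by (rule LeastI_ex)
  then show ?thesis using that by blast
qed

section \<open>Extension of coefficients along \<iota>, and independence of a basis\<close>

context
  fixes \<iota> :: "'f::field \<Rightarrow> 'l::field"
  assumes hom: "field_hom \<iota>"
begin

interpretation field_hom \<iota> by (rule hom)

lemma lookup_map_hom:
  "Poly_Mapping.lookup (Poly_Mapping.map \<iota> f) m = \<iota> (Poly_Mapping.lookup f m)"
  by (simp add: Poly_Mapping.map.rep_eq when_def)

lemma map_hom_add: "Poly_Mapping.map \<iota> (f + g) = Poly_Mapping.map \<iota> f + Poly_Mapping.map \<iota> g"
  by (rule poly_mapping_eqI) (simp add: lookup_map_hom lookup_add hom_add)

lemma map_hom_single:
  "Poly_Mapping.map \<iota> (Poly_Mapping.single a c) = Poly_Mapping.single a (\<iota> c)"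
  by (rule poly_mapping_eqI) (simp add: lookup_map_hom lookup_single when_def)

lemma map_hom_zero: "Poly_Mapping.map \<iota> 0 = 0"
  by (rule poly_mapping_eqI) (simp add: lookup_map_hom)

lemma map_hom_mult:
  fixes f g :: "'f mpol"
  shows "Poly_Mapping.map \<iota> (f * g) = Poly_Mapping.map \<iota> f * Poly_Mapping.map \<iota> g"
proof (induction f rule: poly_mapping_monomial_induct)
  case (add f a b)
  have "Poly_Mapping.map \<iota> (Poly_Mapping.single a b * g) =
      Poly_Mapping.map \<iota> (Poly_Mapping.single a b) * Poly_Mapping.map \<iota> g"
    by (induction g rule: poly_mapping_monomial_induct)
       (simp_all add: map_hom_zero distrib_left map_hom_add map_hom_single mult_single hom_mult)
  then show ?case using add by (simp add: distrib_right map_hom_add)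
qed (simp add: map_hom_zero)

lemma map_hom_forms: "f \<in> forms n d \<Longrightarrow> Poly_Mapping.map \<iota> f \<in> forms n d"
  by (simp add: forms_iff lookup_map_hom)

lemma map_hom_adjoin:
  "f \<in> adjoin A \<Longrightarrow> Poly_Mapping.map \<iota> f \<in> adjoin (Poly_Mapping.map \<iota> ` A)"
  by (induction rule: adjoin.induct)
     (auto simp: map_hom_add map_hom_mult map_hom_single intro: adjoin.intros)

lemma pd_map_hom: "pd i (Poly_Mapping.map \<iota> f) = Poly_Mapping.map \<iota> (pd i f)"
  by (rule poly_mapping_eqI) (simp add: lookup_map_hom lookup_pd hom_mult hom_add hom_of_nat)

text \<open>\<open>is_ext_basis\<close> speaks of a set of vectors; injectivity on
  \<open>{1..n}\<close> turns its independence into that of the indexed family.\<close>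

lemma ext_basis_coeff_zero:
  assumes "is_ext_basis \<iota> n v" "(\<Sum>j\<in>{1..n}. v j * \<iota> (c j)) = 0" "j \<in> {1..n}"
  shows "c j = 0"
proof -
  have vs: "Modules.module (ext_scale \<iota>)"
    by unfold_locales (simp_all add: ext_scale_def algebra_simps hom_add hom_mult)
  have inj: "inj_on v {1..n}" and indep: "\<not> module.dependent (ext_scale \<iota>) (v ` {1..n})"
    using assms(1) by (simp_all add: is_ext_basis_def)
  define g where "g = the_inv_into {1..n} v"
  have g: "g (v j) = j" if "j \<in> {1..n}" for j
    unfolding g_def by (rule the_inv_into_f_f[OF inj that])
  let ?u = "\<lambda>x. c (g x)"
  have "(\<Sum>x\<in>v ` {1..n}. ext_scale \<iota> (?u x) x) = (\<Sum>j\<in>{1..n}. v j * \<iota> (c j))"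
    unfolding sum.reindex[OF inj] by (intro sum.cong) (simp_all add: ext_scale_def g mult.commute)
  then have "?u (v j) = 0"
    using assms(2,3) Modules.module.independentD[OF vs indep, of "v ` {1..n}" ?u "v j"] by simp
  then show ?thesis by (simp add: g[OF assms(3)])
qed

end

section \<open>The Galois group and the fixed field of its generator\<close>

lemma (in field_isom) inv_field_hom: "field_hom (inv_into UNIV hom)"
  by (rule inv.field_hom_axioms)

text \<open>\<open>m_inv\<close> is a definite description, so the inverse function is shown to be
  the only candidate in the carrier. This handles the inverse of the generator in
  \<open>generate\<close>.\<close>

lemma Gal_inv:
  fixes \<sigma> :: "'l::field \<Rightarrow> 'l" and \<iota> :: "'f::field \<Rightarrow> 'l"
  assumes gal: "\<sigma> \<in> carrier (Gal \<iota>)"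
  shows "m_inv (Gal \<iota>) \<sigma> = inv_into UNIV \<sigma>"
proof -
  have "\<sigma> \<in> {\<tau>. field_hom \<tau> \<and> bij \<tau> \<and> (\<forall>c. \<tau> (\<iota> c) = \<iota> c)}"
    using gal by (simp only: Gal_def partial_object.simps)
  then have \<sigma>: "field_hom \<sigma>" "bij \<sigma>" "\<And>c. \<sigma> (\<iota> c) = \<iota> c" by blast+
  have "field_isom \<sigma>"
    by (intro field_isom.intro surjective.intro \<sigma>(1) bij_is_surj \<sigma>(2))
  then have "field_hom (inv_into UNIV \<sigma>)" by (rule field_isom.inv_field_hom)
  moreover have "bij (inv_into UNIV \<sigma>)" using \<sigma>(2) by (rule bij_imp_bij_inv)
  moreover have "inv_into UNIV \<sigma> (\<iota> c) = \<iota> c" for c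
    by (rule inv_f_eq[OF bij_is_inj[OF \<sigma>(2)] \<sigma>(3)])
  ultimately have c: "inv_into UNIV \<sigma> \<in> carrier (Gal \<iota>)"
    unfolding Gal_def by simp
  have m: "x \<otimes>\<^bsub>Gal \<iota>\<^esub> y = x \<circ> y" "\<one>\<^bsub>Gal \<iota>\<^esub> = id" for x y
    by (simp_all add: Gal_def)
  show ?thesis
    unfolding m_inv_def m
  proof (intro the_equality conjI c)
    show "\<sigma> \<circ> inv_into UNIV \<sigma> = id" using bij_is_surj[OF \<sigma>(2)] by (simp add: surj_iff)
    show "inv_into UNIV \<sigma> \<circ> \<sigma> = id" using bij_is_inj[OF \<sigma>(2)] by (simp add: inj_iff)
    show "y = inv_into UNIV \<sigma>"
      if "y \<in> carrier (Gal \<iota>) \<and> \<sigma> \<circ> y = id \<and> y \<circ> \<sigma> = id" for y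
      by (rule inv_unique_comp[symmetric]) (use that in blast)+
  qed
qed

text \<open>A fixed point of \<sigma> is fixed by its inverse too, hence by the generated group,
  whose fixed field is the image of \<iota>.\<close>

lemma cyclic_galois_fixed:
  assumes "cyclic_galois_ext \<iota> n \<sigma>" "\<sigma> x = x"
  shows "x \<in> range \<iota>"
proof -
  have gal: "\<sigma> \<in> carrier (Gal \<iota>)" "generate (Gal \<iota>) {\<sigma>} = carrier (Gal \<iota>)"
    "{x. \<forall>\<tau>\<in>carrier (Gal \<iota>). \<tau> x = x} = range \<iota>"
    using assms(1) unfolding cyclic_galois_ext_def galois_ext_def by blast+
  have "bij \<sigma>" using gal(1) by (simp add: Gal_def)
  then have inv: "inv_into UNIV \<sigma> x = x" by (intro inv_f_eq bij_is_inj assms(2))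
  have "\<tau> x = x" if "\<tau> \<in> generate (Gal \<iota>) {\<sigma>}" for \<tau>
    using that
  proof induction
    case (inv h)
    then show ?case using Gal_inv[OF gal(1)] \<open>inv_into UNIV \<sigma> x = x\<close> by simp
  qed (simp_all add: Gal_def assms(2))
  then show ?thesis unfolding gal(3)[symmetric] gal(2)[symmetric] by blast
qed

section \<open>Orthogonality to the conjugates of a basis\<close>

text \<open>\<alpha> and \<open>h\<close> vary in the induction: the step passes to the image of
  \<alpha> under \<sigma>, which stays independent over F because \<sigma> is injective and fixes F.
  The number of conditions equals the number of terms.\<close>

lemma conjugates_orthogonal_imp_zero:
  fixes \<iota> :: "'f::field \<Rightarrow> 'l::field" and l :: "'i \<Rightarrow> 'j \<Rightarrow> 'f"
  assumes "field_hom \<sigma>" "\<And>c. \<sigma> (\<iota> c) = \<iota> c" "\<And>x. \<sigma> x = x \<Longrightarrow> x \<in> range \<iota>"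
    and "finite I"
    and "\<And>c j. (\<Sum>j\<in>J. \<alpha> j * \<iota> (c j)) = 0 \<Longrightarrow> j \<in> J \<Longrightarrow> c j = 0"
    and "\<iota> 0 = 0"
    and "\<And>s. s < card I \<Longrightarrow> (\<Sum>j\<in>J. (\<sigma> ^^ s) (\<alpha> j) * (\<Sum>i\<in>I. h i * \<iota> (l i j))) = 0"
    and "j \<in> J"
  shows "(\<Sum>i\<in>I. h i * \<iota> (l i j)) = 0"
  using assms(4,5,7,8)
proof (induction I arbitrary: \<alpha> h j rule: finite_induct)
  case empty
  show ?case by simp
next
  case (insert k I)
  interpret \<sigma>: field_hom \<sigma> by (rule assms(1))
  show ?case
  proof (cases "h k = 0")
    case True
    have "(\<Sum>i\<in>I. h i * \<iota> (l i j)) = 0"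
    proof (rule insert.IH)
      show "(\<Sum>j\<in>J. (\<sigma> ^^ s) (\<alpha> j) * (\<Sum>i\<in>I. h i * \<iota> (l i j))) = 0" if "s < card I" for s
        using insert.prems(2)[of s] insert.hyps that True by simp
    qed (use insert.prems in auto)
    then show ?thesis using True insert.hyps by simp
  next
    case False
    define h' where "h' i = h i / h k" for i
    define u where "u j = (\<Sum>i\<in>I. h' i * \<iota> (l i j)) + \<iota> (l k j)" for j
    have u: "(\<Sum>i\<in>insert k I. h i * \<iota> (l i j)) = h k * u j" for j
      using insert.hyps False
      by (simp add: u_def h'_def distrib_left sum_distrib_left)
    have orth: "(\<Sum>j\<in>J. (\<sigma> ^^ s) (\<alpha> j) * u j) = 0" if "s < Suc (card I)" for s
    proof -
      have "h k * (\<Sum>j\<in>J. (\<sigma> ^^ s) (\<alpha> j) * u j) = 0"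
        using insert.prems(2)[of s] that insert.hyps
        unfolding u by (simp add: sum_distrib_left mult.left_commute)
      then show ?thesis using False by simp
    qed
    \<comment> \<open>The term of \<open>k\<close> now has coefficient 1, so \<sigma> fixes it and
      it cancels.\<close>
    have diff: "(\<Sum>i\<in>I. (h' i - \<sigma> (h' i)) * \<iota> (l i j)) = u j - \<sigma> (u j)" for j
      by (simp add: u_def left_diff_distrib sum_subtractf \<sigma>.hom_add \<sigma>.hom_sum \<sigma>.hom_mult assms(2))
    have fixed: "u j = \<sigma> (u j)" if "j \<in> J" for j
    proof -
      have "(\<Sum>i\<in>I. (h' i - \<sigma> (h' i)) * \<iota> (l i j)) = 0"
      proof (rule insert.IH)
        fix c j assume c: "(\<Sum>j\<in>J. \<sigma> (\<alpha> j) * \<iota> (c j)) = 0" and j: "j \<in> J"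
        have "\<sigma> (\<Sum>j\<in>J. \<alpha> j * \<iota> (c j)) = 0"
          using c by (simp add: \<sigma>.hom_sum \<sigma>.hom_mult assms(2))
        then show "c j = 0" using insert.prems(1)[of c] j by simp
      next
        fix s assume s: "s < card I"
        \<comment> \<open>Condition \<open>Suc s\<close> minus the image of condition
          \<open>s\<close> under \<sigma>: one condition is lost together with the term of
          \<open>k\<close>.\<close>
        have "(\<Sum>j\<in>J. (\<sigma> ^^ s) (\<sigma> (\<alpha> j)) * (u j - \<sigma> (u j))) =
            (\<Sum>j\<in>J. (\<sigma> ^^ Suc s) (\<alpha> j) * u j) - \<sigma> (\<Sum>j\<in>J. (\<sigma> ^^ s) (\<alpha> j) * u j)"
          by (simp add: right_diff_distrib sum_subtractf \<sigma>.hom_sum \<sigma>.hom_mult funpow_swap1)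
        also have "\<dots> = 0" using orth[of s] orth[of "Suc s"] s by simp
        finally show "(\<Sum>j\<in>J. (\<sigma> ^^ s) (\<sigma> (\<alpha> j)) *
            (\<Sum>i\<in>I. (h' i - \<sigma> (h' i)) * \<iota> (l i j))) = 0" unfolding diff .
      qed (rule that)
      then show ?thesis unfolding diff by simp
    qed
    have "\<exists>c. u j = \<iota> c" if "j \<in> J" for j
      using assms(3)[of "u j"] fixed[OF that] by auto
    then obtain c where c: "\<And>j. j \<in> J \<Longrightarrow> u j = \<iota> (c j)" by metis
    \<comment> \<open>With the entries of \<open>u\<close> in F, the condition for
      \<open>s = 0\<close> is a linear relation over F among the entries of \<alpha>.\<close>
    have "(\<Sum>j\<in>J. \<alpha> j * \<iota> (c j)) = 0" using orth[of 0] c by simp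
    then have "c j = 0" using insert.prems by blast
    then show ?thesis unfolding u using c insert.prems(3) assms(6) by simp
  qed
qed

lemma form_eq_zero_if_conjugates_annihilate:
  fixes \<iota> :: "'f::field \<Rightarrow> 'l::field"
  assumes ext: "cyclic_galois_ext \<iota> n \<sigma>" and "is_ext_basis \<iota> n \<alpha>"
    and "\<And>i. i \<in> I \<Longrightarrow> l i \<in> forms n 1" "finite I"
    and "g \<in> adjoin (Poly_Mapping.map \<iota> ` l ` I)" "g \<in> forms n k" "(of_nat k :: 'l) \<noteq> 0"
    and "\<And>s. s < card I \<Longrightarrow> diff_act (dir_op n (\<lambda>j. (\<sigma> ^^ s) (\<alpha> j))) g = 0"
  shows "g = 0"
proof -
  have hom: "field_hom \<iota>" and \<sigma>: "field_hom \<sigma>" "\<And>c. \<sigma> (\<iota> c) = \<iota> c"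
    using ext by (auto simp: cyclic_galois_ext_def galois_ext_def Gal_def)
  interpret field_hom \<iota> by (rule hom)
  let ?c = "\<lambda>i j. Poly_Mapping.lookup (l i) (Poly_Mapping.single j 1)"
  have "\<exists>h. \<forall>j. pd j g = (\<Sum>i\<in>I. const_poly (Poly_Mapping.lookup (Poly_Mapping.map \<iota> (l i))
      (Poly_Mapping.single j 1)) * h i)"
    by (rule pd_adjoin_chain_rule[where n = n])
       (use assms(3-5) in \<open>auto simp: image_image intro: map_hom_forms[OF hom]\<close>)
  then obtain h where h: "\<And>j. pd j g = (\<Sum>i\<in>I. const_poly (\<iota> (?c i j)) * h i)"
    unfolding lookup_map_hom[OF hom] by blast
  \<comment> \<open>For fixed \<open>m\<close>, the coefficients of the gradient form a vector over
    L that combines the vectors \<open>?c i\<close> over F. Orthogonality is exploited for each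
    \<open>m\<close> separately.\<close>
  have pd: "Poly_Mapping.lookup (pd j g) m = (\<Sum>i\<in>I. Poly_Mapping.lookup (h i) m * \<iota> (?c i j))" for j m
    unfolding h by (simp add: lookup_sum lookup_const_mult mult.commute[of "\<iota> _"])
  have "Poly_Mapping.lookup (pd j g) m = 0" if "j \<in> {1..n}" for j m
    unfolding pd
  proof (rule conjugates_orthogonal_imp_zero[OF \<sigma>, where \<alpha> = \<alpha> and J = "{1..n}" and l = ?c])
    show "x \<in> range \<iota>" if "\<sigma> x = x" for x by (rule cyclic_galois_fixed[OF ext that])
    show "c j = 0" if "(\<Sum>j\<in>{1..n}. \<alpha> j * \<iota> (c j)) = 0" "j \<in> {1..n}" for c j
      by (rule ext_basis_coeff_zero[OF hom assms(2) that])
    show "(\<Sum>j\<in>{1..n}. (\<sigma> ^^ s) (\<alpha> j) * (\<Sum>i\<in>I. Poly_Mapping.lookup (h i) m * \<iota> (?c i j))) = 0"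
      if "s < card I" for s
      using arg_cong[OF assms(8)[OF that], of "\<lambda>p. Poly_Mapping.lookup p m"]
      by (simp only: diff_act_dir_op lookup_sum lookup_const_mult pd lookup_zero)
  qed (use assms that in auto)
  then have "pd j g = 0" if "j \<in> {1..n}" for j
    using that by (intro poly_mapping_eqI) simp
  then show ?thesis using form_eq_zero_if_pd_zero assms(6,7) by blast
qed

section \<open>Cancelling the factors of the operators\<close>

theorem theorem3p1:
  fixes \<iota> :: "'f::field \<Rightarrow> 'l::field"
    and \<sigma> :: "'l \<Rightarrow> 'l"
    and \<alpha> :: "nat \<Rightarrow> nat \<Rightarrow> 'l"
    and d n \<rho> :: nat
    and f :: "'f mpol"
  assumes "d \<ge> 1" and "n \<ge> 1" and "1 \<le> \<rho>" and "\<rho> \<le> n"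
    and "CHAR('f) = 0 \<or> CHAR('f) > d"
    and "cyclic_galois_ext \<iota> n \<sigma>"
    and "\<forall>j\<in>{1..d}. is_ext_basis \<iota> n (\<alpha> j)"
    and "f \<in> rank_code \<iota> \<sigma> \<rho> n d \<alpha> - {0}"
  shows "ess n f \<ge> \<rho>"
proof (rule ccontr)
  assume "\<not> ess n f \<ge> \<rho>"
  then have less: "ess n f < \<rho>" by simp
  have hom: "field_hom \<iota>" using assms(6) by (simp add: cyclic_galois_ext_def galois_ext_def)
  interpret field_hom \<iota> by (rule hom)
  \<comment> \<open>Every degree from 1 to \<open>d\<close> is met: \<open>d - k\<close> during the
    cancellation and \<open>d\<close> at the end.\<close>
  have char: "(of_nat k :: 'f) \<noteq> 0" if "1 \<le> k" "k \<le> d" for k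
    using assms(5) that by (auto simp: of_nat_eq_0_iff_char_dvd dest: dvd_imp_le)
  have char': "(of_nat k :: 'l) \<noteq> 0" if "1 \<le> k" "k \<le> d" for k
    using char[OF that] by (metis hom_0_iff hom_of_nat)
  let ?F = "Poly_Mapping.map \<iota> f"
  \<comment> \<open>keeps \<open>inc_induct\<close> below from generalising the \<open>1\<close> in \<open>\<alpha> 1\<close>\<close>
  define \<alpha>\<^sub>1 where "\<alpha>\<^sub>1 = \<alpha> 1"
  let ?P = "\<lambda>k r. dir_op n \<alpha>\<^sub>1 * (\<Prod>j\<in>{2..k}. dir_op n (\<lambda>i. (\<sigma> ^^ r j) (\<alpha> j i)))"
  have f: "f \<in> forms n d" "f \<noteq> 0" using assms(8) by (auto simp: rank_code_def)
  obtain l where l: "\<And>i. i \<in> {1..ess n f} \<Longrightarrow> l i \<in> forms n 1" "f \<in> adjoin (l ` {1..ess n f})"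
    using ess_attained[OF f(1)] by blast
  let ?A = "Poly_Mapping.map \<iota> ` l ` {1..ess n f}"
  \<comment> \<open>Descending induction on the number \<open>k\<close> of factors kept, from
    \<open>d\<close> to 1. All \<open>r\<close> are covered at once, as the step varies the exponent
    at \<open>Suc k\<close>; the empty range \<open>{2..1}\<close> displays the goal as the instance
    \<open>k = 1\<close>.\<close>
  have "\<forall>r. (\<forall>j\<in>{2..1}. int (r j) \<le> int \<rho> - 2) \<longrightarrow> diff_act (?P 1 r) ?F = 0"
    using assms(1)
  proof (induction rule: inc_induct)
    case base
    show ?case using assms(8) by (auto simp: rank_code_def perp_def \<alpha>\<^sub>1_def)
  next
    case (step k)
    show ?case
    proof (intro allI impI)
      fix r :: "nat \<Rightarrow> nat" assume r: "\<forall>j\<in>{2..k}. int (r j) \<le> int \<rho> - 2"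
      have split: "{2..Suc k} = insert (Suc k) {2..k}" using step.hyps by auto
      show "diff_act (?P k r) ?F = 0"
      proof (rule form_eq_zero_if_conjugates_annihilate[OF assms(6) _ l(1)])
        show "is_ext_basis \<iota> n (\<alpha> (Suc k))" using assms(7) step.hyps by simp
        show "diff_act (?P k r) ?F \<in> adjoin ?A"
          using l(1) by (intro diff_act_adjoin[where n = n] map_hom_adjoin[OF hom] l(2))
            (auto intro: map_hom_forms[OF hom])
        \<comment> \<open>The \<open>k\<close> first-order factors leave degree
          \<open>d - k\<close>, which is positive because \<open>k < d\<close>.\<close>
        have "Suc (d - k) + card {2..k} = d" using step.hyps by simp
        then show "diff_act (?P k r) ?F \<in> forms n (d - k)"
          unfolding diff_act_mult
          by (intro diff_act_dir_op_forms diff_act_prod_dir_op_forms)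
             (simp_all only: map_hom_forms[OF hom f(1)] finite_atLeastAtMost)
        show "(of_nat (d - k) :: 'l) \<noteq> 0" by (rule char') (use step.hyps in auto)
        fix s assume "s < card {1..ess n f}"
        \<comment> \<open>From \<open>s < ess n f\<close> and \<open>ess n f < \<rho>\<close>
          follows \<open>s \<le> \<rho> - 2\<close>, so \<open>s\<close> is admissible; for \<rho> =
          1 there is no such \<open>s\<close>.\<close>
        then have "\<forall>j\<in>{2..Suc k}. int ((r(Suc k := s)) j) \<le> int \<rho> - 2"
          using r less by auto
        then have "diff_act (?P (Suc k) (r(Suc k := s))) ?F = 0" using step.IH by blast
        \<comment> \<open>The last factor is moved to the front so that it acts on the form produced
          by the first \<open>k\<close> factors.\<close>
        moreover have "?P (Suc k) (r(Suc k := s)) =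
            dir_op n (\<lambda>i. (\<sigma> ^^ s) (\<alpha> (Suc k) i)) * ?P k r"
          unfolding split by (subst prod.insert) (auto simp: mult.left_commute intro!: prod.cong)
        ultimately have
          "diff_act (dir_op n (\<lambda>i. (\<sigma> ^^ s) (\<alpha> (Suc k) i)) * ?P k r) ?F = 0" by (simp only:)
        then show "diff_act (dir_op n (\<lambda>i. (\<sigma> ^^ s) (\<alpha> (Suc k) i))) (diff_act (?P k r) ?F) = 0"
          by (simp only: diff_act_mult)
      qed simp_all
    qed
  qed
  then have \<alpha>1: "diff_act (dir_op n (\<alpha> 1)) ?F = 0" by (simp add: \<alpha>\<^sub>1_def)
  \<comment> \<open>The remaining factor is not conjugated and \<open>pd j f\<close> has
    coefficients in F, so independence of \<open>\<alpha> 1\<close> settles each monomial.\<close>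
  have "pd j f = 0" if "j \<in> {1..n}" for j
  proof (rule poly_mapping_eqI)
    fix m
    have "(\<Sum>j\<in>{1..n}. \<alpha> 1 j * \<iota> (Poly_Mapping.lookup (pd j f) m)) = 0"
      using arg_cong[OF \<alpha>1, of "\<lambda>p. Poly_Mapping.lookup p m"]
      by (simp only: diff_act_dir_op lookup_sum lookup_const_mult pd_map_hom[OF hom]
          lookup_map_hom[OF hom] lookup_zero)
    then show "Poly_Mapping.lookup (pd j f) m = Poly_Mapping.lookup 0 m"
      using ext_basis_coeff_zero[OF hom _ _ that, of "\<alpha> 1" "\<lambda>j. Poly_Mapping.lookup (pd j f) m"]
        assms(1,7) by simp
  qed
  then have "f = 0" using form_eq_zero_if_pd_zero[OF f(1)] char assms(1) by blast
  then show False using f(2) by simp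
qed

end
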